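(* Let $n\ge 2$. For all $A,B_1,\dots,B_n,C\in\widehat{\mathbb{F}_q^\times}$ and all $\lambda_1,\dots,\lambda_n\in\mathbb{F}_q$, $$\mathbb{F}_D^{(n)}\left[\begin{matrix}A; & B_1\ \cdots\ B_n\\ & C\end{matrix};\lambda_1,\dots,\lambda_n\right]=\frac{J(A,\overline{C}B_1B_2\cdots B_n)}{A(-1)\,J(A,C\overline{A})}\;\mathbb{F}_D^{(n)}\left[\begin{matrix}A; & B_1\ \cdots\ B_n\\ & A\overline{C}B_1B_2\cdots B_n\end{matrix};1-\lambda_1,\dots,1-\lambda_n\right].$$
   Context: $\mathbb{F}_q$ is a finite field with $q=p^e$, $p$ an odd prime. $\widehat{\mathbb{F}_q^\times}$ is the group of complex-valued multiplicative characters of $\mathbb{F}_q^\times$; every character $\chi$, including the trivial one, is extended to $\mathbb{F}_q$ by $\chi(0)=0$, and $\overline{\chi}=\chi^{-1}$. The Jacobi sum is $J(A,B)=\sum_{x\in\mathbb{F}_q}A(x)B(1-x)$. The finite-field Appell-Lauricella hypergeometric function is $$\mathbb{F}_D^{(n)}\left[\begin{matrix}A; & B_1\ \cdots\ B_n\\ & C\end{matrix};\lambda_1,\dots,\lambda_n\right]=\frac{1}{J(A,C\overline{A})}\sum_{y\in\mathbb{F}_q}A(y)\,C\overline{A}(1-y)\,\overline{B_1}(1-\lambda_1y)\cdots\overline{B_n}(1-\lambda_ny).$$ *)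

theory Defs
  imports Complex_Main "HOL-Library.Cardinality" "HOL-Computational_Algebra.Primes"
begin

text \<open>
  A multiplicative character is a homomorphism from the unit group of the field to the
  nonzero complex numbers. It is represented by its extension to the whole field by the value
  0 at 0; this convention applies to the trivial character as well.
\<close>

typedef (overloaded) ('a :: field) mult_char =
  "{\<chi> :: 'a \<Rightarrow> complex. \<chi> 0 = 0 \<and> (\<forall>x. x \<noteq> 0 \<longrightarrow> \<chi> x \<noteq> 0) \<and>
      (\<forall>x y. x \<noteq> 0 \<longrightarrow> y \<noteq> 0 \<longrightarrow> \<chi> (x * y) = \<chi> x * \<chi> y)}"
  morphisms char_fun Abs_mult_char
  by (rule exI[of _ "\<lambda>x. if x = 0 then 0 else 1"]) auto

setup_lifting type_definition_mult_char

text \<open>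
  The inverse below, which is also the complex conjugate when the field is finite, relies on
  \<^term>\<open>inverse (0 :: complex) = 0\<close>.
\<close>

instantiation mult_char :: (field) "{comm_monoid_mult, inverse}"
begin

lift_definition one_mult_char :: "'a mult_char" is "\<lambda>x. if x = 0 then 0 else 1"
  by auto

lift_definition times_mult_char :: "'a mult_char \<Rightarrow> 'a mult_char \<Rightarrow> 'a mult_char"
  is "\<lambda>\<chi> \<psi> x. \<chi> x * \<psi> x"
  by auto

lift_definition inverse_mult_char :: "'a mult_char \<Rightarrow> 'a mult_char"
  is "\<lambda>\<chi> x. inverse (\<chi> x)"
  by auto

definition divide_mult_char :: "'a mult_char \<Rightarrow> 'a mult_char \<Rightarrow> 'a mult_char"
  where "divide_mult_char \<chi> \<psi> = \<chi> * inverse \<psi>"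

instance
  by standard (transfer; auto simp: fun_eq_iff mult_ac)+

end

lemma mult_char_left_inverse: "inverse \<chi> * \<chi> = (1 :: 'a :: field mult_char)"
  by transfer (auto simp: fun_eq_iff)

definition jacobi_sum :: "('a :: {field, finite}) mult_char \<Rightarrow> 'a mult_char \<Rightarrow> complex"
  where "jacobi_sum A B = (\<Sum>x\<in>UNIV. char_fun A x * char_fun B (1 - x))"

text \<open>Only the values of \<open>B\<close> and \<open>l\<close> at the indices 1, ..., n matter.\<close>

definition appell_lauricella_FD ::
  "nat \<Rightarrow> ('a :: {field, finite}) mult_char \<Rightarrow> (nat \<Rightarrow> 'a mult_char) \<Rightarrow> 'a mult_char \<Rightarrow>
     (nat \<Rightarrow> 'a) \<Rightarrow> complex"
  where "appell_lauricella_FD n A B C l =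
    1 / jacobi_sum A (C * inverse A) *
    (\<Sum>y\<in>UNIV. char_fun A y * char_fun (C * inverse A) (1 - y) *
       (\<Prod>i=1..n. char_fun (inverse (B i)) (1 - l i * y)))"

end

theory Submission
  imports Defs
begin

text \<open>
  The substitution \<open>y \<mapsto> y / (y - 1)\<close>, an involution of the field without 1, turns
  \<open>1 - \<lambda> y\<close> into \<open>(1 - (1 - \<lambda>) y) / (1 - y)\<close> and so maps one character sum to the other. The
  normalising factors then match because the Jacobi sum that cancels does not vanish:
  \<open>J(A, B) J(inverse A, inverse B)\<close> can be evaluated, and for more than two field elements
  its value is one of \<open>q\<close>, \<open>1\<close>, \<open>(q - 2)\<^sup>2\<close>.
\<close>

lemma char_fun_0 [simp]: "char_fun \<chi> 0 = 0"
  by transfer auto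

lemma char_fun_eq_0_iff [simp]: "char_fun \<chi> x = 0 \<longleftrightarrow> x = 0"
  by transfer auto

lemma char_fun_mult: "char_fun \<chi> (x * y) = char_fun \<chi> x * char_fun \<chi> y"
  by transfer (metis mult_zero_left mult_zero_right)

lemma char_fun_1 [simp]: "char_fun \<chi> 1 = 1"
  using char_fun_mult[of \<chi> 1 1] by simp

lemma char_fun_inverse_arg: "char_fun \<chi> (inverse x) = inverse (char_fun \<chi> x)"
proof (cases "x = 0")
  case False
  then have "char_fun \<chi> x * char_fun \<chi> (inverse x) = 1"
    by (simp flip: char_fun_mult)
  then show ?thesis
    using inverse_unique by metis
qed auto

lemma char_fun_divide: "char_fun \<chi> (x / y) = char_fun \<chi> x / char_fun \<chi> y"
  by (simp add: divide_inverse char_fun_mult char_fun_inverse_arg)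

lemma char_fun_minus_1_square: "char_fun \<chi> (-1) * char_fun \<chi> (-1) = 1"
  by (simp flip: char_fun_mult)

text \<open>At 0 an empty product would break the identity: the trivial character is 0 there, while
  the empty product of values is 1.\<close>

lemma char_fun_prod: "x \<noteq> 0 \<Longrightarrow> char_fun (\<Prod>i\<in>I. \<chi> i) x = (\<Prod>i\<in>I. char_fun (\<chi> i) x)"
  by (induction I rule: infinite_finite_induct)
     (auto simp: one_mult_char.rep_eq times_mult_char.rep_eq)

text \<open>Orthogonality: scaling by some \<open>a\<close> with \<open>char_fun \<chi> a\<close>
  different from 1 permutes the field and multiplies the sum by that value, so the sum is 0.\<close>

lemma sum_char_fun:
  fixes \<chi> :: "'a :: {field, finite} mult_char"
  shows "(\<Sum>x\<in>UNIV. char_fun \<chi> x) = (if \<chi> = 1 then of_nat CARD('a) - 1 else 0)"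
proof (cases "\<chi> = 1")
  case True
  have "(\<Sum>x\<in>UNIV. char_fun \<chi> x) = (\<Sum>x\<in>UNIV - {0::'a}. 1)"
    by (rule sum.mono_neutral_cong_right) (auto simp: True one_mult_char.rep_eq)
  also have "\<dots> = of_nat (CARD('a) - 1)"
    by (simp add: card_Diff_singleton)
  finally show ?thesis
    using True by (simp add: of_nat_diff)
next
  case False
  obtain a where a: "a \<noteq> 0" "char_fun \<chi> a \<noteq> 1"
  proof (rule ccontr)
    assume "\<not> thesis"
    then have "char_fun \<chi> x = char_fun 1 x" for x
      using that by (cases "x = 0") (auto simp: one_mult_char.rep_eq)
    then show False
      using False by (simp add: char_fun_inject[symmetric] fun_eq_iff)
  qed
  have "(\<Sum>x\<in>UNIV. char_fun \<chi> x) = (\<Sum>x\<in>UNIV. char_fun \<chi> (a * x))"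
    by (rule sum.reindex_bij_witness[of _ "\<lambda>x. a * x" "\<lambda>x. x / a"]) (use a in auto)
  also have "\<dots> = char_fun \<chi> a * (\<Sum>x\<in>UNIV. char_fun \<chi> x)"
    by (simp add: char_fun_mult sum_distrib_left)
  finally show ?thesis
    using a False by auto
qed

lemma sum_char_fun_without_0_1:
  fixes \<chi> :: "'a :: {field, finite} mult_char"
  shows "(\<Sum>x\<in>- {0, 1}. char_fun \<chi> x) = (\<Sum>x\<in>UNIV. char_fun \<chi> x) - 1"
proof -
  have "(\<Sum>x\<in>UNIV. char_fun \<chi> x) = (\<Sum>x\<in>insert 1 (- {0, 1}). char_fun \<chi> x)"
    by (rule sum.mono_neutral_right) auto
  also have "\<dots> = 1 + (\<Sum>x\<in>- {0, 1}. char_fun \<chi> x)"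
    by (subst sum.insert) auto
  finally show ?thesis
    by simp
qed

text \<open>Dropping the zero terms at 0 and 1 makes \<open>x\<close> and \<open>1 - x\<close>
  invertible, as the quotients below require.\<close>

lemma jacobi_sum_altdef:
  "jacobi_sum A B = (\<Sum>x\<in>- {0, 1}. char_fun A x * char_fun B (1 - x))"
  unfolding jacobi_sum_def by (rule sum.mono_neutral_right) auto

text \<open>Expand into a sum over pairs of \<open>A (x / y) * B ((1 - x) / (1 - y))\<close>.
  Diagonal terms are 1. Off the diagonal the two quotients serve as new coordinates, so the rest is
  a product of two character sums less its own diagonal.\<close>

lemma jacobi_sum_mult_inverse:
  fixes A B :: "'a :: {field, finite} mult_char"
  shows "jacobi_sum A B * jacobi_sum (inverse A) (inverse B) =
    of_nat (CARD('a) - 2) +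
    ((\<Sum>x\<in>UNIV. char_fun A x) - 1) * ((\<Sum>x\<in>UNIV. char_fun B x) - 1) -
    ((\<Sum>x\<in>UNIV. char_fun (A * B) x) - 1)"
proof -
  define T :: "'a set" where "T = - {0, 1}"
  define D where "D = (\<lambda>x. (x, x)) ` T"
  have D: "D \<subseteq> T \<times> T" "inj_on (\<lambda>x. (x, x)) T"
    by (auto simp: D_def inj_on_def)
  let ?f = "\<lambda>(x, y). char_fun A (x / y) * char_fun B ((1 - x) / (1 - y))"
  let ?g = "\<lambda>(u, v). char_fun A u * char_fun B v"
  have "card T = CARD('a) - 2"
    unfolding T_def by (simp add: Compl_eq_Diff_UNIV card_Diff_subset)
  then have diag: "sum ?f D = of_nat (CARD('a) - 2)"
    unfolding D_def by (subst sum.reindex[OF D(2)]) (simp add: T_def)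
  have off_diag: "sum ?f (T \<times> T - D) = sum ?g (T \<times> T - D)"
  \<comment> \<open>The inverse map solves \<open>x = u * y\<close> and
    \<open>1 - x = v * (1 - y)\<close>, which give \<open>1 - v = (u - v) * y\<close>.\<close>
  proof (rule sum.reindex_bij_witness[of _
        "\<lambda>(u, v). (u * ((1 - v) / (u - v)), (1 - v) / (u - v))"
        "\<lambda>(x, y). (x / y, (1 - x) / (1 - y))"], safe)
    fix x y :: 'a
    assume "x \<in> T" "y \<in> T" "(x, y) \<notin> D"
    then have xy: "x \<noteq> 0" "x \<noteq> 1" "y \<noteq> 0" "1 - y \<noteq> 0" "1 - x \<noteq> 0" "x - y \<noteq> 0"
      by (auto simp: T_def D_def)
    let ?u = "x / y" and ?v = "(1 - x) / (1 - y)"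
    \<comment> \<open>In factored form these differences are visibly nonzero, so the image avoids 1
      and the diagonal.\<close>
    have uv: "?u - ?v = (x - y) / (y * (1 - y))" and v: "1 - ?v = (x - y) / (1 - y)"
      and u: "?u - 1 = (x - y) / y"
      using xy by (simp_all add: field_simps)
    show y: "(1 - ?v) / (?u - ?v) = y"
      unfolding uv v using xy by simp
    show "?u * ((1 - ?v) / (?u - ?v)) = x"
      unfolding y using xy by simp
    show "?u \<in> T"
      using u xy by (auto simp: T_def)
    show "?v \<in> T"
      using v xy by (auto simp: T_def)
    assume "(?u, ?v) \<in> D"
    then have "?u - ?v = 0"
      by (auto simp: D_def)
    then show False
      unfolding uv using xy by simp
  next
    fix u v :: 'a
    assume "u \<in> T" "v \<in> T" "(u, v) \<notin> D"
    then have uv: "u \<noteq> 0" "u - 1 \<noteq> 0" "v \<noteq> 0" "1 - v \<noteq> 0" "u - v \<noteq> 0"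
      by (auto simp: T_def D_def)
    let ?y = "(1 - v) / (u - v)"
    let ?x = "u * ?y"
    have y: "1 - ?y = (u - 1) / (u - v)" and x: "1 - ?x = v * ((u - 1) / (u - v))"
      using uv by (simp_all add: field_simps)
    have y0: "?y \<noteq> 0" "1 - ?y \<noteq> 0" "1 - ?x \<noteq> 0"
      unfolding x y using uv by simp_all
    show "?x / ?y = u"
      using y0 by simp
    show "(1 - ?x) / (1 - ?y) = v"
      unfolding x y using uv by simp
    show "?y \<in> T" "?x \<in> T"
      using y0 uv by (auto simp: T_def)
    assume "(?x, ?y) \<in> D"
    \<comment> \<open>The factor 1 lets \<open>mult_right_cancel\<close> remove \<open>?y\<close>,
      leaving \<open>u = 1\<close>.\<close>
    then have "?x = 1 * ?y"
      by (auto simp: D_def)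
    then show False
      using y0 uv by (simp only: mult_right_cancel) simp
  qed
  have "jacobi_sum A B * jacobi_sum (inverse A) (inverse B) = sum ?f (T \<times> T)"
    unfolding jacobi_sum_altdef T_def sum_product sum.cartesian_product
    by (intro sum.cong refl)
      (auto simp: char_fun_divide inverse_mult_char.rep_eq field_simps)
  also have "\<dots> = sum ?f D + sum ?g (T \<times> T - D)"
    using sum.subset_diff[OF D(1), of ?f] off_diag by simp
  also have "sum ?g (T \<times> T - D) = sum ?g (T \<times> T) - sum ?g D"
    using D(1) by (simp add: sum_diff)
  also have "sum ?g (T \<times> T) = (\<Sum>x\<in>T. char_fun A x) * (\<Sum>x\<in>T. char_fun B x)"
    by (simp add: sum_product sum.cartesian_product)
  also have "sum ?g D = (\<Sum>x\<in>T. char_fun (A * B) x)"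
    unfolding D_def by (subst sum.reindex[OF D(2)]) (simp add: times_mult_char.rep_eq)
  finally show ?thesis
    by (simp add: diag T_def sum_char_fun_without_0_1)
qed

text \<open>The product with the inverse characters is nonzero in every case. Two elements must be
  excluded: there both terms of the Jacobi sum vanish.\<close>

lemma jacobi_sum_nonzero:
  fixes A B :: "'a :: {field, finite} mult_char"
  assumes "CARD('a) > 2"
  shows "jacobi_sum A B \<noteq> 0"
proof
  assume J: "jacobi_sum A B = 0"
  \<comment> \<open>With \<open>q = m + 3\<close> the possible values are \<open>m + 3\<close>, 1
    and \<open>(m + 1)\<^sup>2\<close>, nonzero in characteristic 0.\<close>
  define m where "m = CARD('a) - 3"
  have m: "of_nat CARD('a) - 1 = (of_nat m + 2 :: complex)" "CARD('a) - 2 = m + 1"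
    using assms by (simp_all add: m_def of_nat_diff)
  have eq: "0 = (of_nat m + 1 :: complex) +
      ((if A = 1 then of_nat m + 2 else 0) - 1) * ((if B = 1 then of_nat m + 2 else 0) - 1) -
      ((if A * B = 1 then of_nat m + 2 else 0) - 1)"
    using jacobi_sum_mult_inverse[of A B] unfolding J m(2) sum_char_fun m(1)
    by (simp only: of_nat_add of_nat_1 mult_zero_left)
  have nz: "(of_nat m + 1 :: complex) \<noteq> 0" "(of_nat m + 3 :: complex) \<noteq> 0"
    using of_nat_neq_0[of m, where 'a = complex] of_nat_neq_0[of "m + 2", where 'a = complex]
    by (simp_all add: add_ac)
  show False
  proof (cases "A = 1"; cases "B = 1")
    assume "A = 1" "B = 1"
    then have "(of_nat m + 1 :: complex) * (of_nat m + 1) = 0"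
      using eq by (simp add: algebra_simps)
    then show False
      using nz by simp
  next
    assume "A \<noteq> 1" "B \<noteq> 1"
    then show False
      using eq nz by (cases "A * B = 1") (simp_all add: add_ac)
  \<comment> \<open>If exactly one character is trivial, so that \<open>A * B\<close> is not,
    \<open>eq\<close> reads 0 = 1.\<close>
  qed (use eq in simp_all)
qed

text \<open>With \<open>z = y / (y - 1)\<close>, the powers of \<open>1 - z\<close> collect to
  \<open>inverse C\<close> times the product of the \<open>B i\<close>: the contributions of
  \<open>A\<close> from \<open>y\<close> and from \<open>1 - y\<close> cancel.\<close>

lemma appell_lauricella_sum_reflect:
  fixes A C :: "'a :: {field, finite} mult_char"
    and B :: "nat \<Rightarrow> 'a mult_char"
  shows "(\<Sum>y\<in>UNIV. char_fun A y * char_fun (C * inverse A) (1 - y) *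
       (\<Prod>i\<in>I. char_fun (inverse (B i)) (1 - l i * y))) =
    char_fun A (-1) * (\<Sum>y\<in>UNIV. char_fun A y * char_fun (inverse C * (\<Prod>i\<in>I. B i)) (1 - y) *
       (\<Prod>i\<in>I. char_fun (inverse (B i)) (1 - (1 - l i) * y)))"
    (is "sum ?f UNIV = _ * sum ?g UNIV")
proof -
  \<comment> \<open>The term at 1 is 0 even if \<open>C * inverse A\<close> is trivial.\<close>
  have "sum ?f UNIV = sum ?f (- {1})"
    by (rule sum.mono_neutral_right) auto
  also have "\<dots> = (\<Sum>y\<in>- {1}. char_fun A (-1) * ?g y)"
  proof (rule sum.reindex_bij_witness[of _ "\<lambda>y. y / (y - 1)" "\<lambda>y. y / (y - 1)"], goal_cases)
    \<comment> \<open>Goal 5 equates the summands; the others say that the map is an involution off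
      1.\<close>
    case (5 y)
    then have y: "1 - y \<noteq> 0" "y - 1 \<noteq> 0"
      by auto
    define z where "z = y / (y - 1)"
    \<comment> \<open>Writing \<open>-1 * z\<close> lets \<open>char_fun_mult\<close> split off
      \<open>char_fun A (-1)\<close>.\<close>
    have z: "1 - z \<noteq> 0" and y': "1 - y = 1 / (1 - z)" and y'': "y = -1 * z / (1 - z)"
      using y by (simp_all add: z_def field_simps)
    have A: "char_fun A y = char_fun A (-1) * char_fun A z / char_fun A (1 - z)"
      using arg_cong[OF y'', of "char_fun A"] by (simp only: char_fun_divide char_fun_mult)
    have l: "char_fun (inverse (B i)) (1 - l i * y) =
        char_fun (inverse (B i)) (1 - (1 - l i) * z) * char_fun (B i) (1 - z)" for i
    proof -
      have "1 - l i * y = (1 - (1 - l i) * z) / (1 - z)"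
        using y by (simp add: z_def field_simps)
      then have "char_fun (inverse (B i)) (1 - l i * y) =
          char_fun (inverse (B i)) (1 - (1 - l i) * z) / char_fun (inverse (B i)) (1 - z)"
        by (simp only: char_fun_divide)
      then show ?thesis
        by (simp add: inverse_mult_char.rep_eq divide_inverse)
    qed
    have "char_fun (C * inverse A) (1 - y) = char_fun A (1 - z) / char_fun C (1 - z)"
      unfolding y' char_fun_divide
      by (simp add: times_mult_char.rep_eq inverse_mult_char.rep_eq field_simps)
    moreover have "char_fun (inverse C * (\<Prod>i\<in>I. B i)) (1 - z) =
        (\<Prod>i\<in>I. char_fun (B i) (1 - z)) / char_fun C (1 - z)"
      using z by (simp add: times_mult_char.rep_eq inverse_mult_char.rep_eq char_fun_prod
          divide_inverse)
    moreover have "char_fun A (1 - z) \<noteq> 0"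
      using z by simp
    ultimately show ?case
      unfolding l prod.distrib A z_def[symmetric] by simp
  qed (auto simp: divide_simps)
  also have "\<dots> = (\<Sum>y\<in>UNIV. char_fun A (-1) * ?g y)"
    by (rule sum.mono_neutral_left) auto
  finally show ?thesis
    by (simp add: sum_distrib_left)
qed

theorem corollary6p3:
  fixes A C :: "('a :: {field, finite}) mult_char"
    and B :: "nat \<Rightarrow> 'a mult_char"
    and l :: "nat \<Rightarrow> 'a"
    and p e n :: nat
  assumes "prime p" and "odd p" and "CARD('a) = p ^ e"
    and "n \<ge> 2"
  shows "appell_lauricella_FD n A B C l =
    jacobi_sum A (inverse C * (\<Prod>i=1..n. B i)) /
      (char_fun A (-1) * jacobi_sum A (C * inverse A)) *
    appell_lauricella_FD n A B (A * inverse C * (\<Prod>i=1..n. B i)) (\<lambda>i. 1 - l i)"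
proof -
  let ?D = "inverse C * (\<Prod>i=1..n. B i)"
  have "card {0, 1 :: 'a} \<le> CARD('a)"
    by (rule card_mono) auto
  moreover have "odd CARD('a)"
    using assms by simp
  ultimately have "CARD('a) > 2"
    by (cases "CARD('a) = 2") auto
  then have J: "jacobi_sum A ?D \<noteq> 0"
    by (rule jacobi_sum_nonzero)
  \<comment> \<open>Hence the normalising sum on the right is \<open>jacobi_sum A ?D\<close>, which
    cancels the numerator of the prefactor.\<close>
  have D: "A * inverse C * (\<Prod>i=1..n. B i) * inverse A = ?D"
  proof -
    have "A * inverse C * (\<Prod>i=1..n. B i) * inverse A = inverse A * A * ?D"
      by (simp only: mult_ac)
    then show ?thesis
      by (simp add: mult_char_left_inverse)
  qed
  \<comment> \<open>Reflection multiplies by \<open>char_fun A (-1)\<close> where the claim divides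
    by it; its square is 1.\<close>
  have "1 / K * (a * S) = J / (a * K) * (1 / J * S)"
    if "J \<noteq> 0" "a * a = 1" for J K S a :: complex
  proof -
    have "1 / a = a"
      using that(2) by (metis div_by_1 divide_eq_eq mult_zero_left zero_neq_one)
    moreover have "J / (a * K) * (1 / J * S) = 1 / a * S / K"
      using that(1) by simp
    ultimately show ?thesis
      by simp
  qed
  from this[OF J char_fun_minus_1_square] show ?thesis
    unfolding appell_lauricella_FD_def D appell_lauricella_sum_reflect .
qed

end
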